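(* Let $\Delta>0$ be an integer and let $(\dot P_0,\dot T_0),\dots,(\dot P_{z-1},\dot T_{z-1})$, $z\ge2$, be pairs of strings of lengths at least $\Delta$ such that for every $s\in[0,z-1)$, $\dot P_s[|\dot P_s|-\Delta..|\dot P_s|)=\dot P_{s+1}[0..\Delta)$ and $\dot T_s[|\dot T_s|-\Delta..|\dot T_s|)=\dot T_{s+1}[0..\Delta)$. Let $P=\dot P_0\odot_\Delta\cdots\odot_\Delta\dot P_{z-1}$ and $T=\dot T_0\odot_\Delta\cdots\odot_\Delta\dot T_{z-1}$, and let $\tau=\sum_{s=0}^{z-1}\big||\dot T_s|-|\dot P_s|\big|$. Then for every integer $k\le\lfloor\Delta/2\rfloor-\tau$, $$D_\Delta(P,T)\ \equiv_k\ D^{\mathrm{lead}}_\Delta(\dot P_0,\dot T_0)\oplus\Big(\bigoplus_{s=1}^{z-2}D^{\mathrm{int}}_\Delta(\dot P_s,\dot T_s)\Big)\oplus D^{\mathrm{trail}}_\Delta(\dot P_{z-1},\dot T_{z-1}).$$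
   Context: $w:\bar\Sigma^2\to[0,W]$ is a normalized weight function ($\bar\Sigma=\Sigma\cup\{\varepsilon\}$, $w(a,a)=0$, $w(a,b)\ge1$ for $a\ne b$). The augmented alignment graph $\overline{\mathsf{AG}}^w(X,Y)$ has vertices $\{0..|X|\}\times\{0..|Y|\}$, edges $(x,y)\to(x+1,y)$ of cost $w(X[x],\varepsilon)$, $(x,y)\to(x,y+1)$ of cost $w(\varepsilon,Y[y])$, $(x,y)\to(x+1,y+1)$ of cost $w(X[x],Y[y])$, and for each such edge a reverse edge of cost $W+1$. For strings $X,Y$ with $\Delta\le|Y|$, $D_\Delta(X,Y)$ is the $(\Delta+1)\times(\Delta+1)$ matrix with $D_\Delta(X,Y)[i,j]=\mathrm{dist}_{\overline{\mathsf{AG}}^w(X,Y)}((0,i),(|X|,|Y|-\Delta+j))$. Further $D^{\mathrm{int}}_\Delta(X,Y)=D_\Delta(X[\lfloor\Delta/2\rfloor..|X|-\lceil\Delta/2\rceil),Y)$, $D^{\mathrm{lead}}_\Delta(X,Y)=D_\Delta(X[0..|X|-\lceil\Delta/2\rceil),Y)$, $D^{\mathrm{trail}}_\Delta(X,Y)=D_\Delta(X[\lfloor\Delta/2\rfloor..|X|),Y)$. For strings $S,S'$ with $S[|S|-\Delta..|S|)=S'[0..\Delta)$, $S\odot_\Delta S'=S\cdot S'[\Delta..|S'|)$. $\oplus$ is the $(\min,+)$ matrix product $(A\oplus B)[i,j]=\min_\ell(A[i,\ell]+B[\ell,j])$. Reals $a,b$ are $k$-equivalent ($a\equiv_k b$)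 if $a=b$ or $k\le\min\{a,b\}$; matrices are $k$-equivalent if entrywise so. *)

theory Defs
  imports
    "HOL-Library.Extended_Real"
    "Graph_Theory.Shortest_Path"
    "Jordan_Normal_Form.Matrix"
begin

text \<open>The extended alphabet is \<^typ>\<open>'a option\<close>, with \<^term>\<open>None\<close> in the role of the empty
  symbol $\varepsilon$.\<close>

definition normalized_weight :: "real \<Rightarrow> ('a option \<Rightarrow> 'a option \<Rightarrow> real) \<Rightarrow> bool" where
  "normalized_weight W w \<longleftrightarrow>
     (\<forall>a b. 0 \<le> w a b \<and> w a b \<le> W) \<and>
     (\<forall>a. w a a = 0) \<and>
     (\<forall>a b. a \<noteq> b \<longrightarrow> 1 \<le> w a b)"

definition AG_edges :: "'a list \<Rightarrow> 'a list \<Rightarrow> ((nat \<times> nat) \<times> (nat \<times> nat)) set" where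
  "AG_edges X Y =
     {((x, y), (x + 1, y)) | x y. x < length X \<and> y \<le> length Y} \<union>
     {((x, y), (x, y + 1)) | x y. x \<le> length X \<and> y < length Y} \<union>
     {((x, y), (x + 1, y + 1)) | x y. x < length X \<and> y < length Y}"

definition AAG :: "'a list \<Rightarrow> 'a list \<Rightarrow> (nat \<times> nat, (nat \<times> nat) \<times> (nat \<times> nat)) pre_digraph" where
  "AAG X Y =
     \<lparr>verts = {0..length X} \<times> {0..length Y},
      arcs = AG_edges X Y \<union> (AG_edges X Y)\<inverse>,
      tail = fst, head = snd\<rparr>"

text \<open>The sets of forward and reverse edges are disjoint, so the last case is exactly the case of
  a reverse edge.\<close>

definition AAG_cost ::
    "('a option \<Rightarrow> 'a option \<Rightarrow> real) \<Rightarrow> real \<Rightarrow> 'a list \<Rightarrow> 'a list \<Rightarrow>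
     (nat \<times> nat) \<times> (nat \<times> nat) \<Rightarrow> real" where
  "AAG_cost w W X Y = (\<lambda>((x, y), v).
     if v = (x + 1, y) then w (Some (X ! x)) None
     else if v = (x, y + 1) then w None (Some (Y ! y))
     else if v = (x + 1, y + 1) then w (Some (X ! x)) (Some (Y ! y))
     else W + 1)"

definition AAG_dist ::
    "('a option \<Rightarrow> 'a option \<Rightarrow> real) \<Rightarrow> real \<Rightarrow> 'a list \<Rightarrow> 'a list \<Rightarrow>
     nat \<times> nat \<Rightarrow> nat \<times> nat \<Rightarrow> ereal" where
  "AAG_dist w W X Y = wf_digraph.\<mu> (AAG X Y) (AAG_cost w W X Y)"

text \<open>The half-open fragment $X[a..b)$.\<close>

definition fragment :: "'a list \<Rightarrow> nat \<Rightarrow> nat \<Rightarrow> 'a list" where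
  "fragment X a b = take (b - a) (drop a X)"

text \<open>Meant for \<^prop>\<open>\<Delta> \<le> length Y\<close>. The entries are distances in a strongly connected graph
  and hence finite (lemma \<open>D_mat_finite\<close> below); they are kept in \<^typ>\<open>ereal\<close> because the unit of
  the $(\min,+)$ product, i.e. its empty product, has infinite entries.\<close>

definition D_mat ::
    "('a option \<Rightarrow> 'a option \<Rightarrow> real) \<Rightarrow> real \<Rightarrow> nat \<Rightarrow> 'a list \<Rightarrow> 'a list \<Rightarrow> ereal mat" where
  "D_mat w W \<Delta> X Y = mat (\<Delta> + 1) (\<Delta> + 1)
     (\<lambda>(i, j). AAG_dist w W X Y (0, i) (length X, length Y - \<Delta> + j))"

text \<open>Here \<^term>\<open>(\<Delta> + 1) div 2\<close> is $\lceil\Delta/2\rceil$.\<close>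

definition D_int ::
    "('a option \<Rightarrow> 'a option \<Rightarrow> real) \<Rightarrow> real \<Rightarrow> nat \<Rightarrow> 'a list \<Rightarrow> 'a list \<Rightarrow> ereal mat" where
  "D_int w W \<Delta> X Y = D_mat w W \<Delta> (fragment X (\<Delta> div 2) (length X - (\<Delta> + 1) div 2)) Y"

definition D_lead ::
    "('a option \<Rightarrow> 'a option \<Rightarrow> real) \<Rightarrow> real \<Rightarrow> nat \<Rightarrow> 'a list \<Rightarrow> 'a list \<Rightarrow> ereal mat" where
  "D_lead w W \<Delta> X Y = D_mat w W \<Delta> (fragment X 0 (length X - (\<Delta> + 1) div 2)) Y"

definition D_trail ::
    "('a option \<Rightarrow> 'a option \<Rightarrow> real) \<Rightarrow> real \<Rightarrow> nat \<Rightarrow> 'a list \<Rightarrow> 'a list \<Rightarrow> ereal mat" where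
  "D_trail w W \<Delta> X Y = D_mat w W \<Delta> (fragment X (\<Delta> div 2) (length X)) Y"

text \<open>Only meaningful if the last \<open>\<Delta>\<close> symbols of \<open>S\<close> are the first \<open>\<Delta>\<close> symbols of \<open>S'\<close>.\<close>

definition odot :: "nat \<Rightarrow> 'a list \<Rightarrow> 'a list \<Rightarrow> 'a list" where
  "odot \<Delta> S S' = S @ fragment S' \<Delta> (length S')"

definition minplus :: "ereal mat \<Rightarrow> ereal mat \<Rightarrow> ereal mat"  (infixl "\<boxplus>" 70) where
  "A \<boxplus> B = mat (dim_row A) (dim_col B)
     (\<lambda>(i, j). Min ((\<lambda>l. A $$ (i, l) + B $$ (l, j)) ` {0..<dim_col A}))"

definition minplus_one :: "nat \<Rightarrow> ereal mat" where
  "minplus_one n = mat n n (\<lambda>(i, j). if i = j then 0 else \<infinity>)"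

text \<open>The product of a (possibly empty) list of \<open>n \<times> n\<close> matrices.\<close>

definition minplus_prod :: "nat \<Rightarrow> ereal mat list \<Rightarrow> ereal mat" where
  "minplus_prod n Ms = foldr (\<boxplus>) Ms (minplus_one n)"

definition k_equiv :: "int \<Rightarrow> ereal \<Rightarrow> ereal \<Rightarrow> bool" where
  "k_equiv k a b \<longleftrightarrow> a = b \<or> ereal (of_int k) \<le> min a b"

definition k_equiv_mat :: "int \<Rightarrow> ereal mat \<Rightarrow> ereal mat \<Rightarrow> bool" where
  "k_equiv_mat k A B \<longleftrightarrow>
     dim_row A = dim_row B \<and> dim_col A = dim_col B \<and>
     (\<forall>i < dim_row A. \<forall>j < dim_col A. k_equiv k (A $$ (i, j)) (B $$ (i, j)))"

lemma wf_digraph_AAG: "wf_digraph (AAG X Y)"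
  by unfold_locales (auto simp: AAG_def AG_edges_def)

lemma AAG_cost_nonneg:
  assumes "normalized_weight W w"
  shows "0 \<le> AAG_cost w W X Y e"
proof -
  have "0 \<le> W" using assms unfolding normalized_weight_def by (meson order_trans)
  then show ?thesis using assms
    by (auto simp: AAG_cost_def normalized_weight_def split: prod.splits)
qed

lemma AAG_arc_reachable:
  assumes "(u, v) \<in> arcs (AAG X Y)"
  shows "u \<rightarrow>\<^sup>*\<^bsub>AAG X Y\<^esub> v"
proof -
  interpret wf_digraph "AAG X Y" by (rule wf_digraph_AAG)
  have "(u, v) \<in> arcs_ends (AAG X Y)"
    using assms by (force simp: arcs_ends_def arc_to_ends_def AAG_def)
  then show ?thesis by (rule reachable_adjI)
qed

lemma AAG_reachable_origin:
  assumes "x \<le> length X" "y \<le> length Y"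
  shows "(0, 0) \<rightarrow>\<^sup>*\<^bsub>AAG X Y\<^esub> (x, y) \<and> (x, y) \<rightarrow>\<^sup>*\<^bsub>AAG X Y\<^esub> (0, 0)"
proof -
  interpret wf_digraph "AAG X Y" by (rule wf_digraph_AAG)
  have col: "(0, 0) \<rightarrow>\<^sup>*\<^bsub>AAG X Y\<^esub> (x, 0) \<and> (x, 0) \<rightarrow>\<^sup>*\<^bsub>AAG X Y\<^esub> (0, 0)"
    using assms(1)
  proof (induction x)
    case 0
    have "(0, 0) \<in> verts (AAG X Y)" by (simp add: AAG_def)
    then show ?case by auto
  next
    case (Suc x)
    have "(x, 0) \<rightarrow>\<^sup>*\<^bsub>AAG X Y\<^esub> (Suc x, 0)" "(Suc x, 0) \<rightarrow>\<^sup>*\<^bsub>AAG X Y\<^esub> (x, 0)"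
      using Suc.prems by - (rule AAG_arc_reachable; simp add: AAG_def AG_edges_def)+
    with Suc show ?case by (auto intro: reachable_trans)
  qed
  show ?thesis
    using assms(2)
  proof (induction y)
    case 0
    show ?case by (rule col)
  next
    case (Suc y)
    have "(x, y) \<rightarrow>\<^sup>*\<^bsub>AAG X Y\<^esub> (x, Suc y)" "(x, Suc y) \<rightarrow>\<^sup>*\<^bsub>AAG X Y\<^esub> (x, y)"
      using Suc.prems assms(1) by - (rule AAG_arc_reachable; simp add: AAG_def AG_edges_def)+
    with Suc show ?case by (auto intro: reachable_trans)
  qed
qed

lemma AAG_dist_finite:
  assumes "normalized_weight W w"
    and "u \<in> verts (AAG X Y)" "v \<in> verts (AAG X Y)"
  shows "\<bar>AAG_dist w W X Y u v\<bar> \<noteq> \<infinity>" "0 \<le> AAG_dist w W X Y u v"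
proof -
  interpret wf_digraph "AAG X Y" by (rule wf_digraph_AAG)
  have uv: "fst u \<le> length X" "snd u \<le> length Y" "fst v \<le> length X" "snd v \<le> length Y"
    using assms(2,3) by (auto simp: AAG_def)
  have "u \<rightarrow>\<^sup>*\<^bsub>AAG X Y\<^esub> v"
    using AAG_reachable_origin[of "fst u" X "snd u" Y] AAG_reachable_origin[of "fst v" X "snd v" Y]
      uv by (auto intro: reachable_trans)
  then obtain p where "awalk u p v" by (auto simp: reachable_awalk)
  then have le: "AAG_dist w W X Y u v \<le> ereal (awalk_cost (AAG_cost w W X Y) p)"
    unfolding AAG_dist_def by (rule min_cost_le_walk_cost)
  show ge: "0 \<le> AAG_dist w W X Y u v"
    unfolding AAG_dist_def \<mu>_def
    by (auto intro!: INF_greatest pos_cost_pos_awalk_cost AAG_cost_nonneg[OF assms(1)]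
        simp del: split_paired_All)
  show "\<bar>AAG_dist w W X Y u v\<bar> \<noteq> \<infinity>"
    using le ge by auto
qed

lemma D_mat_finite:
  assumes "normalized_weight W w" "\<Delta> \<le> length Y" "i \<le> \<Delta>" "j \<le> \<Delta>"
  shows "\<bar>D_mat w W \<Delta> X Y $$ (i, j)\<bar> \<noteq> \<infinity>"
  using assms AAG_dist_finite(1)[OF assms(1), of "(0, i)" X Y "(length X, length Y - \<Delta> + j)"]
  by (auto simp: D_mat_def AAG_def)

end

theory Submission
  imports Defs
begin

text \<open>Let $p_s$ and $t_s$ be the positions of the $s$-th pieces in $P$ and $T$. The right-hand side
  is the cost of a cheapest walk that meets each row $p_s+\lfloor\Delta/2\rfloor$ in a column of
  $[t_s..t_s+\Delta]$ and stays, between consecutive such rows, within the columns of the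
  corresponding piece of $T$; hence it is at least the left-hand side. Conversely, a walk can be cut
  at these rows into pieces that never leave their row strips, because within one row a horizontal
  walk is always cheapest. Every unit by which a walk changes its diagonal costs at least $1$, so
  a walk of cost less than $k$ stays so close to the diagonals of its two ends that all its pieces
  obey the column restrictions.\<close>

section \<open>Walks with explicit cost, confined to a vertex set\<close>

text \<open>\<open>cwalk w W X Y S u c v\<close>: a walk of cost \<open>c\<close> from \<open>u\<close> to \<open>v\<close> with all vertices in \<open>S\<close>.\<close>

inductive cwalk ::
    "('a option \<Rightarrow> 'a option \<Rightarrow> real) \<Rightarrow> real \<Rightarrow> 'a list \<Rightarrow> 'a list \<Rightarrow> (nat \<times> nat) set \<Rightarrow>
     nat \<times> nat \<Rightarrow> real \<Rightarrow> nat \<times> nat \<Rightarrow> bool"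
  for w W X Y S u where
    cwalk_Nil: "u \<in> S \<Longrightarrow> cwalk w W X Y S u 0 u"
  | cwalk_Snoc: "cwalk w W X Y S u c v \<Longrightarrow> (v, v') \<in> arcs (AAG X Y) \<Longrightarrow> v' \<in> S \<Longrightarrow>
      cwalk w W X Y S u (c + AAG_cost w W X Y (v, v')) v'"

text \<open>The edge-by-edge estimates below split into these six kinds of edge; carrying the cost
  in each case spares unfolding \<open>AAG_cost\<close> there.\<close>

lemma AAG_arcE:
  assumes "(u, v) \<in> arcs (AAG X Y)"
  obtains x y where "u = (x, y)" "v = (Suc x, y)" "x < length X" "y \<le> length Y"
      "AAG_cost w W X Y (u, v) = w (Some (X ! x)) None"
  | x y where "u = (x, y)" "v = (x, Suc y)" "x \<le> length X" "y < length Y"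
      "AAG_cost w W X Y (u, v) = w None (Some (Y ! y))"
  | x y where "u = (x, y)" "v = (Suc x, Suc y)" "x < length X" "y < length Y"
      "AAG_cost w W X Y (u, v) = w (Some (X ! x)) (Some (Y ! y))"
  | x y where "u = (Suc x, y)" "v = (x, y)" "x < length X" "y \<le> length Y"
      "AAG_cost w W X Y (u, v) = W + 1"
  | x y where "u = (x, Suc y)" "v = (x, y)" "x \<le> length X" "y < length Y"
      "AAG_cost w W X Y (u, v) = W + 1"
  | x y where "u = (Suc x, Suc y)" "v = (x, y)" "x < length X" "y < length Y"
      "AAG_cost w W X Y (u, v) = W + 1"
  using assms by (auto simp: AAG_def AG_edges_def AAG_cost_def)

lemma normalized_weightD:
  assumes "normalized_weight W w"
  shows "0 \<le> w a b" "w a b \<le> W" "a \<noteq> b \<Longrightarrow> 1 \<le> w a b" "1 \<le> W"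
proof -
  show "0 \<le> w a b" "w a b \<le> W" "a \<noteq> b \<Longrightarrow> 1 \<le> w a b"
    using assms by (auto simp: normalized_weight_def)
  \<comment> \<open>\<open>None\<close> and \<open>Some undefined\<close> are two distinct symbols
    over any alphabet, so some weight lies between 1 and \<open>W\<close>.\<close>
  have "1 \<le> w None (Some undefined)" "w None (Some undefined) \<le> W"
    using assms by (auto simp: normalized_weight_def)
  then show "1 \<le> W" by linarith
qed

lemma cwalk_ends:
  assumes "cwalk w W X Y S u c v"
  shows "u \<in> S" "v \<in> S"
  using assms by (induction rule: cwalk.induct) auto

lemma cwalk_mono:
  assumes "cwalk w W X Y S u c v" "S \<subseteq> S'"
  shows "cwalk w W X Y S' u c v"
  using assms by (induction rule: cwalk.induct) (auto intro: cwalk.intros)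

lemma cwalk_trans:
  assumes "cwalk w W X Y S v d v'" "cwalk w W X Y S u c v"
  shows "cwalk w W X Y S u (c + d) v'"
  using assms
proof (induction rule: cwalk.induct)
  case (cwalk_Snoc d v v')
  then show ?case
    using cwalk.cwalk_Snoc[of w W X Y S u "c + d" v v'] by (simp add: add.assoc)
qed simp

lemma cwalk_cost_nonneg:
  assumes "normalized_weight W w" "cwalk w W X Y S u c v"
  shows "0 \<le> c"
  using assms(2) by (induction rule: cwalk.induct) (auto simp: AAG_cost_nonneg[OF assms(1)])

text \<open>A visited vertex splits the walk into two walks whose costs add up to \<open>c\<close>.
  Recording this in the confining set lets any property of such split vertices shrink that set, via
  \<open>cwalk_mono\<close>.\<close>

lemma cwalk_through:
  assumes "cwalk w W X Y S u c v"
  shows "cwalk w W X Y {q \<in> S. \<exists>c1 c2. cwalk w W X Y S u c1 q \<and> cwalk w W X Y S q c2 v \<and> c1 + c2 = c} u c v"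
  using assms
proof (induction rule: cwalk.induct)
  case cwalk_Nil
  then show ?case by (force intro: cwalk.cwalk_Nil)
next
  case (cwalk_Snoc c v v')
  let ?S = "\<lambda>c v. {q \<in> S. \<exists>c1 c2. cwalk w W X Y S u c1 q \<and> cwalk w W X Y S q c2 v \<and> c1 + c2 = c}"
  let ?d = "AAG_cost w W X Y (v, v')"
  have "?S c v \<subseteq> ?S (c + ?d) v'"
  proof safe
    fix a b c1 c2
    assume "cwalk w W X Y S u c1 (a, b)" "cwalk w W X Y S (a, b) c2 v"
    then show "\<exists>c1' c2'. cwalk w W X Y S u c1' (a, b) \<and> cwalk w W X Y S (a, b) c2' v' \<and>
        c1' + c2' = c1 + c2 + ?d"
      using cwalk.cwalk_Snoc[OF _ cwalk_Snoc.hyps(2,3), of w W "(a, b)" c2]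
      by (intro exI[of _ c1] exI[of _ "c2 + ?d"]) simp
  qed
  then have "cwalk w W X Y (?S (c + ?d) v') u c v"
    by (rule cwalk_mono[OF cwalk_Snoc.IH])
  moreover have "v' \<in> ?S (c + ?d) v'"
    using cwalk.cwalk_Snoc[OF cwalk_Snoc.hyps] cwalk.cwalk_Nil[OF cwalk_Snoc.hyps(3), of w W X Y]
      cwalk_Snoc.hyps(3) by force
  ultimately show ?case
    using cwalk.cwalk_Snoc cwalk_Snoc.hyps(2) by blast
qed

section \<open>Lower bounds on the cost of a walk by potentials\<close>

definition diagonal :: "nat \<times> nat \<Rightarrow> real" where
  "diagonal u = real (snd u) - real (fst u)"

text \<open>Diagonal edges of either direction keep the diagonal. Any other edge shifts it by one
  and costs at least 1, since it compares a symbol with \<open>None\<close> or is a reverse edge of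
  cost \<open>W + 1\<close>.\<close>

lemma cwalk_diagonal:
  assumes "normalized_weight W w" "cwalk w W X Y S u c v"
  shows "\<bar>diagonal v - diagonal u\<bar> \<le> c"
  using assms(2)
proof (induction rule: cwalk.induct)
  case (cwalk_Snoc c v v')
  note wt = normalized_weightD[OF assms(1)]
  have "\<bar>diagonal v' - diagonal v\<bar> \<le> AAG_cost w W X Y (v, v')"
    using cwalk_Snoc.hyps(2)
    by (cases rule: AAG_arcE[where w = w and W = W]) (use wt(1,4) in \<open>auto simp: diagonal_def wt(3)\<close>)
  with cwalk_Snoc.IH show ?case by linarith
qed simp

text \<open>Take as potential of a vertex the insertion cost of its column prefix minus
  \<open>W + 1\<close> times its row. No edge raises it by more than its cost: an insertion is
  tight, a diagonal edge inserts at most \<open>W\<close> but increases the row, and a reverse edge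
  that lowers the row pays exactly the \<open>W + 1\<close> that the row term returns. Between
  vertices of one row the row term cancels.\<close>

lemma cwalk_insertion_potential:
  assumes "normalized_weight W w" "cwalk w W X Y S u c v"
  shows "(\<Sum>j<snd v. w None (Some (Y ! j))) - (\<Sum>j<snd u. w None (Some (Y ! j)))
    \<le> c + (W + 1) * (real (fst v) - real (fst u))"
  using assms(2)
proof (induction rule: cwalk.induct)
  case (cwalk_Snoc c v v')
  note wt = normalized_weightD[OF assms(1)]
  \<comment> \<open>These settle in turn deletions, diagonal edges and reversed insertions.\<close>
  have wt': "0 \<le> w a b + W + 1" "w a b \<le> w a' b' + W + 1" "- w a b \<le> 1 + W" for a b a' b'
    using wt(1,2)[of a b] wt(1)[of a' b'] wt(4) by linarith+
  have "(\<Sum>j<snd v'. w None (Some (Y ! j))) - (\<Sum>j<snd v. w None (Some (Y ! j)))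
      \<le> AAG_cost w W X Y (v, v') + (W + 1) * (real (fst v') - real (fst v))"
    using cwalk_Snoc.hyps(2)
    by (cases rule: AAG_arcE[where w = w and W = W])
      (use wt(1,4) wt' in \<open>auto simp: algebra_simps add_nonneg_nonneg\<close>)
  with cwalk_Snoc.IH show ?case by (simp add: algebra_simps)
qed simp

text \<open>Only reverse edges decrease the column; each does so by at most one and costs
  \<open>W + 1\<close>.\<close>

lemma cwalk_leftward_cost:
  assumes "normalized_weight W w" "cwalk w W X Y S u c v"
  shows "(W + 1) * (real (snd u) - real (snd v)) \<le> c"
  using assms(2)
proof (induction rule: cwalk.induct)
  case (cwalk_Snoc c v v')
  note wt = normalized_weightD[OF assms(1)]
  have wt': "- 1 \<le> W + w a b" for a b
    using wt(1)[of a b] wt(4) by linarith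
  have "(W + 1) * (real (snd v) - real (snd v')) \<le> AAG_cost w W X Y (v, v')"
    using cwalk_Snoc.hyps(2)
    by (cases rule: AAG_arcE[where w = w and W = W])
      (use wt(1,4) wt' in \<open>auto simp: algebra_simps\<close>)
  with cwalk_Snoc.IH show ?case by (simp add: algebra_simps)
qed simp

section \<open>Horizontal walks and cutting a walk at rows\<close>

lemma cwalk_rightward:
  assumes "y \<le> y'" "y' \<le> length Y" "m \<le> length X"
  shows "cwalk w W X Y ({m} \<times> {0..length Y}) (m, y)
    ((\<Sum>j<y'. w None (Some (Y ! j))) - (\<Sum>j<y. w None (Some (Y ! j)))) (m, y')"
  using assms
proof (induction y' rule: dec_induct)
  case base
  then show ?case using cwalk_Nil[of "(m, y)" "{m} \<times> {0..length Y}"] by simp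
next
  case (step n)
  have "((m, n), (m, Suc n)) \<in> arcs (AAG X Y)"
    using step.prems by (auto simp: AAG_def AG_edges_def)
  from cwalk_Snoc[OF step.IH this] step.prems
  show ?case by (simp add: AAG_cost_def algebra_simps)
qed

lemma cwalk_leftward:
  assumes "y' \<le> y" "y \<le> length Y" "m \<le> length X"
  shows "cwalk w W X Y ({m} \<times> {0..length Y}) (m, y) ((W + 1) * (real y - real y')) (m, y')"
  using assms
proof (induction y' rule: inc_induct)
  case base
  then show ?case using cwalk_Nil[of "(m, y)" "{m} \<times> {0..length Y}"] by simp
next
  case (step n)
  have "((m, Suc n), (m, n)) \<in> arcs (AAG X Y)"
    using step.prems step.hyps by (auto simp: AAG_def AG_edges_def)
  from cwalk_Snoc[OF step.IH this] step.prems step.hyps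
  show ?case by (simp add: AAG_cost_def algebra_simps)
qed

text \<open>Between two vertices of one row the horizontal walk is cheapest: any other walk pays
  \<^term>\<open>W + 1\<close> to descend for each row it climbs, which is at least the saving of a
  diagonal edge over an insertion.\<close>

lemma cwalk_straighten:
  assumes "normalized_weight W w" "cwalk w W X Y S (m, y) c (m, y')"
    and "S \<subseteq> {0..length X} \<times> {0..length Y}"
  shows "\<exists>c' \<le> c. cwalk w W X Y ({m} \<times> {0..length Y}) (m, y) c' (m, y')"
proof (cases "y \<le> y'")
  case True
  have "m \<le> length X" "y' \<le> length Y" using cwalk_ends[OF assms(2)] assms(3) by auto
  from cwalk_rightward[OF True this(2,1), of w W] show ?thesis
    using cwalk_insertion_potential[OF assms(1,2)] by auto
next
  case False
  have "m \<le> length X" "y \<le> length Y" using cwalk_ends[OF assms(2)] assms(3) by auto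
  from cwalk_leftward[OF _ this(2,1), of y' w W] show ?thesis
    using False cwalk_leftward_cost[OF assms(1,2)] by auto
qed

text \<open>Induction over the edges. The first claim is carried along because the walk may pass
  beyond row \<open>m\<close> and return: the excursion is then straightened into row
  \<open>m\<close>, so that the walk fits into the strip up to \<open>m\<close> again. Straightening
  may lower the cost, hence the inequalities.\<close>

lemma cwalk_split_row:
  assumes "normalized_weight W w" "cwalk w W X Y ({a..b} \<times> {0..length Y}) u c v"
    and "a \<le> m" "m \<le> b" "b \<le> length X" "fst u \<le> m"
  shows "(fst v \<le> m \<longrightarrow> (\<exists>c' \<le> c. cwalk w W X Y ({a..m} \<times> {0..length Y}) u c' v)) \<and>
    (m \<le> fst v \<longrightarrow> (\<exists>y c1 c2. cwalk w W X Y ({a..m} \<times> {0..length Y}) u c1 (m, y) \<and>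
       cwalk w W X Y ({m..b} \<times> {0..length Y}) (m, y) c2 v \<and> c1 + c2 \<le> c))"
  using assms(2)
proof (induction rule: cwalk.induct)
  case cwalk_Nil
  have 1: "cwalk w W X Y ({a..m} \<times> {0..length Y}) u 0 u"
    by (rule cwalk.cwalk_Nil) (use cwalk_Nil assms(6) in \<open>auto simp: mem_Times_iff\<close>)
  have 2: "cwalk w W X Y ({m..b} \<times> {0..length Y}) u 0 u" if "m \<le> fst u"
    by (rule cwalk.cwalk_Nil) (use that cwalk_Nil in \<open>auto simp: mem_Times_iff\<close>)
  show ?case
    using 1 2 assms(6) by (metis add_0 le_antisym order_refl prod.collapse)
next
  case (cwalk_Snoc c v v')
  let ?A = "{a..m} \<times> {0..length Y}" and ?B = "{m..b} \<times> {0..length Y}"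
  let ?d = "AAG_cost w W X Y (v, v')"
  have rows: "fst v' \<le> m" if "fst v < m"
    using cwalk_Snoc.hyps(2) that by (cases rule: AAG_arcE[where w = w and W = W]) auto
  have rows': "m \<le> fst v'" if "m < fst v"
    using cwalk_Snoc.hyps(2) that by (cases rule: AAG_arcE[where w = w and W = W]) auto
  \<comment> \<open>An edge changes the row by at most one, so it cannot jump over row
    \<open>m\<close>.\<close>
  consider "fst v \<le> m" "fst v' \<le> m" | "m \<le> fst v" "m \<le> fst v'"
    using rows rows' by linarith
  then show ?case
  proof cases
    case 1
    then obtain c' where c': "c' \<le> c" "cwalk w W X Y ?A u c' v"
      using cwalk_Snoc.IH by auto
    have A: "cwalk w W X Y ?A u (c' + ?d) v'"
      by (rule cwalk.cwalk_Snoc[OF c'(2) cwalk_Snoc.hyps(2)])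
        (use 1 cwalk_Snoc.hyps(3) in \<open>auto simp: mem_Times_iff\<close>)
    have B: "cwalk w W X Y ?B v' 0 v'" if "m \<le> fst v'"
      by (rule cwalk.cwalk_Nil) (use that cwalk_Snoc.hyps(3) in \<open>auto simp: mem_Times_iff\<close>)
    have "(\<exists>y c1 c2. cwalk w W X Y ?A u c1 (m, y) \<and> cwalk w W X Y ?B (m, y) c2 v' \<and> c1 + c2 \<le> c + ?d)"
      if "m \<le> fst v'"
    proof -
      have "v' = (m, snd v')" using that 1 by (simp add: prod_eq_iff)
      then show ?thesis using A B[OF that] c'(1) by (metis add.right_neutral add_mono order_refl)
    qed
    then show ?thesis using A c'(1) by (meson add_right_mono)
  next
    case 2
    then obtain y c1 c2 where y: "cwalk w W X Y ?A u c1 (m, y)" "cwalk w W X Y ?B (m, y) c2 v" "c1 + c2 \<le> c"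
      using cwalk_Snoc.IH by auto
    have B: "cwalk w W X Y ?B (m, y) (c2 + ?d) v'"
      by (rule cwalk.cwalk_Snoc[OF y(2) cwalk_Snoc.hyps(2)])
        (use 2 cwalk_Snoc.hyps(3) in \<open>auto simp: mem_Times_iff\<close>)
    \<comment> \<open>The walk is back in row \<open>m\<close>; its part since \<open>(m, y)\<close>
      is replaced by a horizontal walk, which lies in \<open>?A\<close> as well.\<close>
    have "\<exists>c' \<le> c + ?d. cwalk w W X Y ?A u c' v'" if "fst v' \<le> m"
    proof -
      have v': "v' = (m, snd v')" using that 2 by (simp add: prod_eq_iff)
      have "?B \<subseteq> {0..length X} \<times> {0..length Y}" using assms(5) by auto
      with B v' obtain d where d: "d \<le> c2 + ?d"
          "cwalk w W X Y ({m} \<times> {0..length Y}) (m, y) d v'"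
        using cwalk_straighten[OF assms(1)] by metis
      have "cwalk w W X Y ?A (m, y) d v'"
        by (rule cwalk_mono[OF d(2)]) (use assms(3) in auto)
      from cwalk_trans[OF this y(1)] d(1) y(3) show ?thesis
        by (intro exI[of _ "c1 + d"]) auto
    qed
    moreover have "c1 + (c2 + ?d) \<le> c + ?d" using y(3) by simp
    ultimately show ?thesis using y(1) B by blast
  qed
qed


text \<open>Repeated cutting: the piece beyond row \<open>x n\<close> is cut again at row
  \<open>x (Suc n)\<close>. Consecutive rows may coincide, and \<open>d n\<close> belongs to the
  remaining piece that runs to the end of the walk.\<close>

lemma cwalk_split_rows:
  assumes "normalized_weight W w" "cwalk w W X Y ({x 0..b} \<times> {0..length Y}) (x 0, y0) c v"
    and "\<And>s. s < n \<Longrightarrow> x s \<le> x (Suc s)" "x n \<le> fst v" "b \<le> length X"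
  shows "\<exists>y d. y 0 = y0 \<and>
    (\<forall>s<n. cwalk w W X Y ({x s..x (Suc s)} \<times> {0..length Y}) (x s, y s) (d s) (x (Suc s), y (Suc s))) \<and>
    cwalk w W X Y ({x n..b} \<times> {0..length Y}) (x n, y n) (d n) v \<and> (\<Sum>s\<le>n. d s) \<le> c"
  using assms(3,4)
proof (induction n)
  case 0
  show ?case by (rule exI[of _ "\<lambda>_. y0"], rule exI[of _ "\<lambda>_. c"]) (use assms(2) in simp)
next
  case (Suc n)
  have le: "x n \<le> x (Suc n)" using Suc.prems(1) by simp
  then obtain y d where yd: "y 0 = y0"
    "\<forall>s<n. cwalk w W X Y ({x s..x (Suc s)} \<times> {0..length Y}) (x s, y s) (d s) (x (Suc s), y (Suc s))"
    "cwalk w W X Y ({x n..b} \<times> {0..length Y}) (x n, y n) (d n) v" "(\<Sum>s\<le>n. d s) \<le> c"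
    using Suc.IH Suc.prems by force
  have "x (Suc n) \<le> b" using cwalk_ends(2)[OF yd(3)] Suc.prems(2) by (auto simp: mem_Times_iff)
  from cwalk_split_row[OF assms(1) yd(3) le this assms(5)] le Suc.prems(2)
  obtain y' d1 d2 where *: "cwalk w W X Y ({x n..x (Suc n)} \<times> {0..length Y}) (x n, y n) d1 (x (Suc n), y')"
      "cwalk w W X Y ({x (Suc n)..b} \<times> {0..length Y}) (x (Suc n), y') d2 v" "d1 + d2 \<le> d n"
    by auto
  let ?y = "y(Suc n := y')" and ?d = "d(n := d1, Suc n := d2)"
  have "(\<Sum>s<n. ?d s) = (\<Sum>s<n. d s)" by (rule sum.cong) auto
  then have "(\<Sum>s\<le>Suc n. ?d s) \<le> c"
    using yd(4) *(3) by (simp add: atMost_Suc lessThan_Suc_atMost[symmetric] del: fun_upd_apply)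
      (simp add: algebra_simps)
  moreover have "\<forall>s<Suc n. cwalk w W X Y ({x s..x (Suc s)} \<times> {0..length Y}) (x s, ?y s) (?d s)
      (x (Suc s), ?y (Suc s))"
    using yd(2) *(1) by (auto simp: less_Suc_eq)
  ultimately show ?case
    using yd(1) *(2) by (intro exI[of _ ?y] exI[of _ ?d]) simp
qed

section \<open>Fragments of strings as subgrids of the alignment graph\<close>

lemma length_fragment: "b \<le> length X \<Longrightarrow> length (fragment X a b) = b - a"
  by (simp add: fragment_def)

lemma nth_fragment: "i < b - a \<Longrightarrow> b \<le> length X \<Longrightarrow> fragment X a b ! i = X ! (i + a)"
  by (simp add: fragment_def add.commute)

lemma fragment_append: "b \<le> length A \<Longrightarrow> fragment (A @ B) a b = fragment A a b"
  by (cases "a \<le> length A") (auto simp: fragment_def)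

lemma fragment_fragment: "a + d \<le> b \<Longrightarrow> fragment (fragment X a b) c d = fragment X (a + c) (a + d)"
  by (simp add: fragment_def drop_take add.commute)

lemma fragment_full: "fragment X 0 (length X) = X"
  by (simp add: fragment_def)

text \<open>Bounding both ends instead of the traversed symbols makes the description symmetric, so
  that it can be translated by plain arithmetic.\<close>

lemma AAG_arc_iff:
  "((x, y), (x', y')) \<in> arcs (AAG X Y) \<longleftrightarrow>
    x \<le> length X \<and> x' \<le> length X \<and> y \<le> length Y \<and> y' \<le> length Y \<and>
    (x' = Suc x \<and> y' = y \<or> x' = x \<and> y' = Suc y \<or> x' = Suc x \<and> y' = Suc y \<or>
     x = Suc x' \<and> y = y' \<or> x = x' \<and> y = Suc y' \<or> x = Suc x' \<and> y = Suc y')"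
  (is "?L \<longleftrightarrow> ?R")
proof
  show "?L \<Longrightarrow> ?R"
    by (erule AAG_arcE) simp_all
  show "?R \<Longrightarrow> ?L"
    by (elim conjE disjE) (simp_all add: AAG_def AG_edges_def)
qed

text \<open>The graph of two fragments is the box of rows \<open>a\<close> to \<open>b\<close> and
  columns \<open>e\<close> to \<open>f\<close> of the whole graph, moved to the origin. Both borders
  belong to it, since vertices are positions between symbols.\<close>

lemma AAG_arc_fragment_iff:
  assumes "a \<le> b" "b \<le> length X" "e \<le> f" "f \<le> length Y"
  shows "((x, y), (x', y')) \<in> arcs (AAG (fragment X a b) (fragment Y e f)) \<longleftrightarrow>
    ((x + a, y + e), (x' + a, y' + e)) \<in> arcs (AAG X Y) \<and>
    x + a \<le> b \<and> x' + a \<le> b \<and> y + e \<le> f \<and> y' + e \<le> f"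
proof -
  have shift: "n \<le> b - a \<longleftrightarrow> n + a \<le> b" "n \<le> f - e \<longleftrightarrow> n + e \<le> f"
    "n + a = Suc (n' + a) \<longleftrightarrow> n = Suc n'" "n + e = Suc (n' + e) \<longleftrightarrow> n = Suc n'" for n n'
    using assms by auto
  have long: "n \<le> b \<Longrightarrow> n \<le> length X" "n \<le> f \<Longrightarrow> n \<le> length Y" for n
    using assms by auto
  show ?thesis
    unfolding AAG_arc_iff length_fragment[OF assms(2)] length_fragment[OF assms(4)] shift add_right_cancel
    using long by blast
qed

lemma AAG_cost_fragment:
  assumes "b \<le> length X" "f \<le> length Y"
    and "((x, y), (x', y')) \<in> arcs (AAG (fragment X a b) (fragment Y e f))"
  shows "AAG_cost w W (fragment X a b) (fragment Y e f) ((x, y), (x', y')) =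
    AAG_cost w W X Y ((x + a, y + e), (x' + a, y' + e))"
  using assms(3) unfolding AAG_arc_iff length_fragment[OF assms(1)] length_fragment[OF assms(2)]
  by (elim conjE disjE) (simp_all add: AAG_cost_def nth_fragment assms(1,2))

lemma cwalk_of_fragment:
  assumes "cwalk w W (fragment X a b) (fragment Y e f) (verts (AAG (fragment X a b) (fragment Y e f))) u c v"
    and "a \<le> b" "b \<le> length X" "e \<le> f" "f \<le> length Y"
  shows "cwalk w W X Y ({a..b} \<times> {e..f}) (fst u + a, snd u + e) c (fst v + a, snd v + e)"
  using assms(1)
proof (induction rule: cwalk.induct)
  case cwalk_Nil
  show ?case
    by (rule cwalk.cwalk_Nil) (use cwalk_Nil assms(2-5) in \<open>auto simp: AAG_def length_fragment\<close>)
next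
  case (cwalk_Snoc c v v')
  obtain x y x' y' where v: "v = (x, y)" "v' = (x', y')" by fastforce
  note arc = cwalk_Snoc.hyps(2)[unfolded v]
  from arc have "((x + a, y + e), (x' + a, y' + e)) \<in> arcs (AAG X Y)" "x' + a \<le> b" "y' + e \<le> f"
    unfolding AAG_arc_fragment_iff[OF assms(2-5)] by auto
  with cwalk_Snoc.IH show ?case
    unfolding v AAG_cost_fragment[OF assms(3,5) arc] by (auto intro: cwalk.cwalk_Snoc)
qed

text \<open>Truncated subtraction is exact here: every vertex of the walk, also \<open>u\<close>,
  lies in the box.\<close>

lemma cwalk_to_fragment:
  assumes "cwalk w W X Y ({a..b} \<times> {e..f}) u c v"
    and "a \<le> b" "b \<le> length X" "e \<le> f" "f \<le> length Y"
  shows "cwalk w W (fragment X a b) (fragment Y e f) (verts (AAG (fragment X a b) (fragment Y e f)))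
    (fst u - a, snd u - e) c (fst v - a, snd v - e)"
  using assms(1)
proof (induction rule: cwalk.induct)
  case cwalk_Nil
  show ?case
    by (rule cwalk.cwalk_Nil) (use cwalk_Nil assms(2-5) in \<open>auto simp: AAG_def length_fragment\<close>)
next
  case (cwalk_Snoc c v v')
  have "v \<in> {a..b} \<times> {e..f}" by (rule cwalk_ends(2)[OF cwalk_Snoc.hyps(1)])
  then obtain x y where v: "v = (x + a, y + e)" "x + a \<le> b" "y + e \<le> f"
    by (metis SigmaE atLeastAtMost_iff le_add_diff_inverse2)
  obtain x' y' where v': "v' = (x' + a, y' + e)" "x' + a \<le> b" "y' + e \<le> f"
    using cwalk_Snoc.hyps(3) by (metis SigmaE atLeastAtMost_iff le_add_diff_inverse2)
  have arc: "((x, y), (x', y')) \<in> arcs (AAG (fragment X a b) (fragment Y e f))"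
    unfolding AAG_arc_fragment_iff[OF assms(2-5)] using cwalk_Snoc.hyps(2) v v' by simp
  have "(x', y') \<in> verts (AAG (fragment X a b) (fragment Y e f))"
    using v' assms by (auto simp: AAG_def length_fragment)
  from cwalk.cwalk_Snoc[OF _ arc this, of w W] cwalk_Snoc.IH show ?case
    unfolding v v' AAG_cost_fragment[OF assms(3,5) arc, symmetric] by simp
qed

section \<open>Distances as costs of confined walks\<close>

lemma tail_head_AAG: "tail (AAG X Y) = fst" "head (AAG X Y) = snd"
  by (simp_all add: AAG_def)

lemma cwalk_imp_awalk:
  assumes "cwalk w W X Y (verts (AAG X Y)) u c v"
  shows "\<exists>p. pre_digraph.awalk (AAG X Y) u p v \<and> wf_digraph.awalk_cost (AAG_cost w W X Y) p = c"
proof -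
  interpret wf_digraph "AAG X Y" by (rule wf_digraph_AAG)
  show ?thesis
    using assms
  proof (induction rule: cwalk.induct)
    case cwalk_Nil
    then show ?case by (intro exI[of _ "[]"]) (simp add: awalk_Nil_iff)
  next
    case (cwalk_Snoc c v v')
    then obtain p where p: "awalk u p v" "awalk_cost (AAG_cost w W X Y) p = c" by blast
    have "awalk v [(v, v')] v'"
      using cwalk_Snoc.hyps(2,3) by (simp add: awalk_Cons_iff awalk_Nil_iff tail_head_AAG)
    with p show ?case
      by (intro exI[of _ "p @ [(v, v')]"]) (auto intro: awalk_appendI)
  qed
qed

lemma awalk_imp_cwalk:
  assumes "pre_digraph.awalk (AAG X Y) u p v"
  shows "cwalk w W X Y (verts (AAG X Y)) u (wf_digraph.awalk_cost (AAG_cost w W X Y) p) v"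
proof -
  interpret wf_digraph "AAG X Y" by (rule wf_digraph_AAG)
  show ?thesis
    using assms
  proof (induction p arbitrary: v rule: rev_induct)
    case Nil
    then show ?case by (auto simp: awalk_Nil_iff intro: cwalk_Nil)
  next
    case (snoc e p)
    then have p: "awalk u p (fst e)" "e \<in> arcs (AAG X Y)" "snd e = v" "v \<in> verts (AAG X Y)"
      by (auto simp: awalk_Cons_iff awalk_Nil_iff tail_head_AAG)
    then have "(fst e, v) \<in> arcs (AAG X Y)" "e = (fst e, v)" by auto
    from cwalk_Snoc[OF snoc.IH[OF p(1)] this(1) p(4)] this(2) show ?case by simp
  qed
qed

lemma AAG_dist_le:
  assumes "cwalk w W X Y (verts (AAG X Y)) u c v"
  shows "AAG_dist w W X Y u v \<le> ereal c"
  using cwalk_imp_awalk[OF assms] wf_digraph.min_cost_le_walk_cost[OF wf_digraph_AAG]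
  unfolding AAG_dist_def by fastforce

text \<open>The graph is finite and costs are nonnegative, so the infimum over walks is attained by
  a simple path; any two vertices are connected through the origin.\<close>

lemma AAG_dist_attained:
  assumes "normalized_weight W w" "u \<in> verts (AAG X Y)" "v \<in> verts (AAG X Y)"
  shows "\<exists>c. cwalk w W X Y (verts (AAG X Y)) u c v \<and> AAG_dist w W X Y u v = ereal c"
proof -
  interpret wf_digraph "AAG X Y" by (rule wf_digraph_AAG)
  have fin: "finite (verts (AAG X Y))" by (simp add: AAG_def)
  moreover have "arcs (AAG X Y) \<subseteq> verts (AAG X Y) \<times> verts (AAG X Y)"
    by (auto simp: AAG_def AG_edges_def)
  ultimately interpret fin_digraph "AAG X Y"
    by unfold_locales (auto intro: finite_subset)
  have "u \<rightarrow>\<^sup>*\<^bsub>AAG X Y\<^esub> (0, 0)" "(0, 0) \<rightarrow>\<^sup>*\<^bsub>AAG X Y\<^esub> v"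
    using AAG_reachable_origin[of "fst u" X "snd u" Y] AAG_reachable_origin[of "fst v" X "snd v" Y]
      assms(2,3) by (auto simp: AAG_def)
  then have "u \<rightarrow>\<^sup>*\<^bsub>AAG X Y\<^esub> v" by (rule reachable_trans)
  from min_cost_awalk[OF this, of "AAG_cost w W X Y"] AAG_cost_nonneg[OF assms(1)]
  show ?thesis
    unfolding AAG_dist_def by (auto simp: apath_def intro: awalk_imp_cwalk)
qed

lemma AAG_dist_self:
  assumes "normalized_weight W w" "u \<in> verts (AAG X Y)"
  shows "AAG_dist w W X Y u u = 0"
  using AAG_dist_le[OF cwalk_Nil[OF assms(2)], of w W] AAG_dist_finite(2)[OF assms assms(2)]
  by (simp add: zero_ereal_def[symmetric])

lemma AAG_dist_triangle:
  assumes "normalized_weight W w"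
    and "u \<in> verts (AAG X Y)" "m \<in> verts (AAG X Y)" "v \<in> verts (AAG X Y)"
  shows "AAG_dist w W X Y u v \<le> AAG_dist w W X Y u m + AAG_dist w W X Y m v"
proof -
  obtain c d where "cwalk w W X Y (verts (AAG X Y)) u c m" "AAG_dist w W X Y u m = ereal c"
    "cwalk w W X Y (verts (AAG X Y)) m d v" "AAG_dist w W X Y m v = ereal d"
    using AAG_dist_attained[OF assms(1)] assms(2-4) by metis
  then show ?thesis using AAG_dist_le[OF cwalk_trans] by fastforce
qed

text \<open>Walks of the fragment graph are walks of the whole graph that stay in a box, and
  confinement can only raise a distance.\<close>

lemma AAG_dist_fragment_ge:
  assumes "normalized_weight W w" "a \<le> b" "b \<le> length X" "e \<le> f" "f \<le> length Y"
    and "x + a \<le> b" "x' + a \<le> b" "y + e \<le> f" "y' + e \<le> f"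
  shows "AAG_dist w W X Y (x + a, y + e) (x' + a, y' + e) \<le>
    AAG_dist w W (fragment X a b) (fragment Y e f) (x, y) (x', y')"
proof -
  let ?V = "verts (AAG (fragment X a b) (fragment Y e f))"
  have "(x, y) \<in> ?V" "(x', y') \<in> ?V"
    using assms by (auto simp: AAG_def length_fragment)
  then obtain c where c: "cwalk w W (fragment X a b) (fragment Y e f) ?V (x, y) c (x', y')"
      "AAG_dist w W (fragment X a b) (fragment Y e f) (x, y) (x', y') = ereal c"
    using AAG_dist_attained[OF assms(1)] by blast
  from cwalk_of_fragment[OF c(1) assms(2-5)]
  have "cwalk w W X Y ({a..b} \<times> {e..f}) (x + a, y + e) c (x' + a, y' + e)" by simp
  then have "cwalk w W X Y (verts (AAG X Y)) (x + a, y + e) c (x' + a, y' + e)"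
    by (rule cwalk_mono) (use assms in \<open>auto simp: AAG_def\<close>)
  from AAG_dist_le[OF this] c(2) show ?thesis by simp
qed

lemma AAG_dist_fragment_le:
  assumes "cwalk w W X Y ({a..b} \<times> {e..f}) (x + a, y + e) c (x' + a, y' + e)"
    and "a \<le> b" "b \<le> length X" "e \<le> f" "f \<le> length Y"
  shows "AAG_dist w W (fragment X a b) (fragment Y e f) (x, y) (x', y') \<le> ereal c"
  using AAG_dist_le[OF cwalk_to_fragment[OF assms]] by simp

section \<open>Positions of the pieces within the glued string\<close>

definition overlap_offset :: "nat \<Rightarrow> (nat \<Rightarrow> 'a list) \<Rightarrow> nat \<Rightarrow> nat" where
  "overlap_offset \<Delta> Xs s = (\<Sum>r<s. length (Xs r) - \<Delta>)"

text \<open>Piece \<open>s\<close> adds \<open>length (Xs s) - \<Delta>\<close> to the offset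
  because the next piece starts at its last \<Delta> symbols. In the induction the last \<Delta>
  symbols glued so far are those of the last piece, hence the first \<Delta> of the next one, and
  the appended symbols complete it.\<close>

lemma foldl_odot_fragment:
  assumes "\<And>s. s \<le> n \<Longrightarrow> \<Delta> \<le> length (Xs s)"
    and "\<And>s. s < n \<Longrightarrow>
      fragment (Xs s) (length (Xs s) - \<Delta>) (length (Xs s)) = fragment (Xs (s + 1)) 0 \<Delta>"
    and "X = foldl (odot \<Delta>) (Xs 0) (map Xs [1..<Suc n])"
  shows "length X = overlap_offset \<Delta> Xs (Suc n) + \<Delta> \<and>
    (\<forall>s\<le>n. Xs s = fragment X (overlap_offset \<Delta> Xs s) (overlap_offset \<Delta> Xs (Suc s) + \<Delta>))"
  using assms
proof (induction n arbitrary: X)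
  case 0
  then show ?case using fragment_full[of "Xs 0"] by (simp add: overlap_offset_def)
next
  case (Suc n)
  let ?o = "overlap_offset \<Delta> Xs"
  define Z where "Z = foldl (odot \<Delta>) (Xs 0) (map Xs [1..<Suc n])"
  have Z: "length Z = ?o (Suc n) + \<Delta>" "\<forall>s\<le>n. Xs s = fragment Z (?o s) (?o (Suc s) + \<Delta>)"
    using Suc.IH[OF _ _ Z_def] Suc.prems(1,2) by auto
  have oS: "?o (Suc s) = ?o s + (length (Xs s) - \<Delta>)" for s
    by (simp add: overlap_offset_def)
  have mono: "?o (Suc s) \<le> ?o (Suc n)" if "s \<le> n" for s
    unfolding overlap_offset_def by (rule sum_mono2) (use that in auto)
  have len: "\<Delta> \<le> length (Xs (Suc n))" "\<Delta> \<le> length (Xs n)" using Suc.prems(1) by auto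
  have X: "X = Z @ drop \<Delta> (Xs (Suc n))"
    unfolding Suc.prems(3) Z_def by (simp add: odot_def fragment_def)
  have "drop (?o (Suc n)) Z = drop (length (Xs n) - \<Delta>) (drop (?o n) Z)"
    by (simp add: oS add.commute)
  also have "drop (?o n) Z = Xs n"
    using Z(2)[rule_format, of n] Z(1) oS[of n] len(2) by (simp add: fragment_def)
  also have "drop (length (Xs n) - \<Delta>) (Xs n) = take \<Delta> (Xs (Suc n))"
    using Suc.prems(2)[of n] len(2) by (simp add: fragment_def)
  finally have tail: "drop (?o (Suc n)) Z = take \<Delta> (Xs (Suc n))" .
  have lenX: "length X = ?o (Suc (Suc n)) + \<Delta>"
    using X Z(1) len(1) oS[of "Suc n"] by simp
  have "fragment X (?o (Suc n)) (?o (Suc (Suc n)) + \<Delta>) = drop (?o (Suc n)) X"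
    using lenX by (simp add: fragment_def)
  also have "\<dots> = Xs (Suc n)"
    using X tail Z(1) by simp
  finally have "Xs (Suc n) = fragment X (?o (Suc n)) (?o (Suc (Suc n)) + \<Delta>)" by simp
  \<comment> \<open>Earlier pieces end inside \<open>Z\<close>, so appending leaves their fragments
    unchanged.\<close>
  moreover have "Xs s = fragment X (?o s) (?o (Suc s) + \<Delta>)" if "s \<le> n" for s
    unfolding X using Z mono[OF that] that by (simp add: fragment_append)
  ultimately show ?case using lenX by (metis le_Suc_eq)
qed

section \<open>Bounds for products over (min,+)\<close>

lemma minplus_ge:
  assumes "i < dim_row A" "j < dim_col B" "0 < dim_col A"
    and "\<And>l. l < dim_col A \<Longrightarrow> c \<le> A $$ (i, l) + B $$ (l, j)"
  shows "c \<le> (A \<boxplus> B) $$ (i, j)"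
  using assms by (simp add: minplus_def)

lemma minplus_le:
  assumes "i < dim_row A" "j < dim_col B" "l < dim_col A"
  shows "(A \<boxplus> B) $$ (i, j) \<le> A $$ (i, l) + B $$ (l, j)"
  using assms by (simp add: minplus_def)

lemma dim_minplus: "dim_row (A \<boxplus> B) = dim_row A" "dim_col (A \<boxplus> B) = dim_col B"
  by (simp_all add: minplus_def)

lemma dim_minplus_prod:
  assumes "\<And>M. M \<in> set Ms \<Longrightarrow> M \<in> carrier_mat n n"
  shows "dim_row (minplus_prod n Ms) = n" "dim_col (minplus_prod n Ms) = n"
  using assms by (induction Ms) (auto simp: minplus_prod_def minplus_one_def dim_minplus)

text \<open>\<open>G s\<close> bounds from below the cost still to pay from layer \<open>s\<close>
  to index \<open>j\<close> of layer \<open>N\<close>; the last assumption is a triangle inequality.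
  At layer \<open>N\<close> the condition concerns index \<open>j\<close> alone, because the other
  entries of that column of the unit matrix are infinite.\<close>

lemma minplus_prod_ge:
  assumes "m \<le> N" "\<And>s. s \<in> {m..<N} \<Longrightarrow> M s \<in> carrier_mat n n" "i < n" "j < n"
    and "G N j \<le> 0"
    and "\<And>s i l. s \<in> {m..<N} \<Longrightarrow> i < n \<Longrightarrow> l < n \<Longrightarrow> G s i \<le> M s $$ (i, l) + G (Suc s) l"
  shows "G m i \<le> minplus_prod n (map M [m..<N]) $$ (i, j)"
  using assms(1,2,3,6)
proof (induction m arbitrary: i rule: inc_induct)
  case base
  then show ?case using assms(4,5) by (simp add: minplus_prod_def minplus_one_def)
next
  case (step m)
  let ?B = "minplus_prod n (map M [Suc m..<N])"
  have M: "M m \<in> carrier_mat n n" using step.hyps step.prems(1) by simp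
  have dB: "dim_row ?B = n" "dim_col ?B = n"
    by (rule dim_minplus_prod; use step.prems(1) in auto)+
  have eq: "minplus_prod n (map M [m..<N]) = M m \<boxplus> ?B"
    using step.hyps by (simp add: upt_conv_Cons minplus_prod_def)
  have "G m i \<le> (M m \<boxplus> ?B) $$ (i, j)"
  proof (rule minplus_ge)
    fix l assume "l < dim_col (M m)"
    then have l: "l < n" using M by simp
    have "G (Suc m) l \<le> ?B $$ (l, j)" using step l by simp
    moreover have "G m i \<le> M m $$ (i, l) + G (Suc m) l" using step l by simp
    ultimately show "G m i \<le> M m $$ (i, l) + ?B $$ (l, j)"
      by (meson add_left_mono order_trans)
  qed (use M dB assms(4) step.prems in auto)
  then show ?case by (simp only: eq)
qed

text \<open>Choosing one index \<open>l s\<close> per layer gives a path through the layers, and the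
  minimum is at most its cost.\<close>

lemma minplus_prod_le:
  assumes "m \<le> N" "\<And>s. s \<in> {m..<N} \<Longrightarrow> M s \<in> carrier_mat n n"
    and "\<And>s. s \<in> {m..N} \<Longrightarrow> l s < n"
  shows "minplus_prod n (map M [m..<N]) $$ (l m, l N) \<le> (\<Sum>s\<in>{m..<N}. M s $$ (l s, l (Suc s)))"
  using assms
proof (induction m rule: inc_induct)
  case base
  then show ?case by (simp add: minplus_prod_def minplus_one_def)
next
  case (step m)
  let ?B = "minplus_prod n (map M [Suc m..<N])"
  have M: "dim_row (M m) = n" "dim_col (M m) = n"
    using step.hyps step.prems(1)[of m] by auto
  have dB: "dim_row ?B = n" "dim_col ?B = n"
    by (rule dim_minplus_prod; use step.prems(1) in auto)+
  have "(M m \<boxplus> ?B) $$ (l m, l N) \<le> M m $$ (l m, l (Suc m)) + ?B $$ (l (Suc m), l N)"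
    by (rule minplus_le) (use M dB step.hyps step.prems in auto)
  also have "\<dots> \<le> M m $$ (l m, l (Suc m)) + (\<Sum>s\<in>{Suc m..<N}. M s $$ (l s, l (Suc s)))"
    by (rule add_left_mono) (use step in auto)
  finally show ?case
    using step.hyps by (simp add: upt_conv_Cons minplus_prod_def sum.atLeast_Suc_lessThan)
qed


section \<open>Drift of diagonals along a sequence of pieces\<close>

lemma abs_sum_window_le:
  fixes f :: "nat \<Rightarrow> int"
  assumes "m \<le> n" "n \<le> N"
  shows "\<bar>(\<Sum>r<n. f r) - (\<Sum>r<m. f r)\<bar> \<le> (\<Sum>r=0..<N. \<bar>f r\<bar>)"
proof -
  have "(\<Sum>r<n. f r) - (\<Sum>r<m. f r) = (\<Sum>r\<in>{m..<n}. f r)"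
    using sum.atLeastLessThan_concat[of 0 m n f] assms(1) by (simp add: lessThan_atLeast0)
  also have "\<bar>\<dots>\<bar> \<le> (\<Sum>r\<in>{m..<n}. \<bar>f r\<bar>)" by (rule sum_abs)
  also have "\<dots> \<le> (\<Sum>r=0..<N. \<bar>f r\<bar>)" by (rule sum_mono2) (use assms in auto)
  finally show ?thesis .
qed

lemma diagonal_chain:
  assumes "normalized_weight W w" "m \<le> n"
    and "\<And>s. s \<in> {m..<n} \<Longrightarrow> cwalk w W X Y (S s) (v s) (d s) (v (Suc s))"
  shows "\<bar>diagonal (v n) - diagonal (v m)\<bar> \<le> (\<Sum>s\<in>{m..<n}. d s)"
  using assms(2,3)
proof (induction n rule: dec_induct)
  case (step n)
  have "\<bar>diagonal (v (Suc n)) - diagonal (v n)\<bar> \<le> d n"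
    by (rule cwalk_diagonal[OF assms(1)]) (use step in auto)
  with step show ?case by fastforce
qed simp

theorem theorem5p25:
  fixes w :: "'a option \<Rightarrow> 'a option \<Rightarrow> real" and W :: real
    and \<Delta> z :: nat and k \<tau> :: int
    and Pd Td :: "nat \<Rightarrow> 'a list" and P T :: "'a list"
  assumes "normalized_weight W w"
    and "\<Delta> > 0" and "z \<ge> 2"
    and "\<And>s. s < z \<Longrightarrow> \<Delta> \<le> length (Pd s)"
    and "\<And>s. s < z \<Longrightarrow> \<Delta> \<le> length (Td s)"
    and "\<And>s. s < z - 1 \<Longrightarrow>
           fragment (Pd s) (length (Pd s) - \<Delta>) (length (Pd s)) = fragment (Pd (s + 1)) 0 \<Delta>"
    and "\<And>s. s < z - 1 \<Longrightarrow>
           fragment (Td s) (length (Td s) - \<Delta>) (length (Td s)) = fragment (Td (s + 1)) 0 \<Delta>"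
    and "P = foldl (odot \<Delta>) (Pd 0) (map Pd [1..<z])"
    and "T = foldl (odot \<Delta>) (Td 0) (map Td [1..<z])"
    and "\<tau> = (\<Sum>s = 0..<z. \<bar>int (length (Td s)) - int (length (Pd s))\<bar>)"
    and "k \<le> int (\<Delta> div 2) - \<tau>"
  shows "k_equiv_mat k (D_mat w W \<Delta> P T)
           (D_lead w W \<Delta> (Pd 0) (Td 0)
            \<boxplus> minplus_prod (\<Delta> + 1) (map (\<lambda>s. D_int w W \<Delta> (Pd s) (Td s)) [1..<z - 1])
            \<boxplus> D_trail w W \<Delta> (Pd (z - 1)) (Td (z - 1)))"
proof -
  note nw = assms(1)
  let ?p = "overlap_offset \<Delta> Pd" and ?t = "overlap_offset \<Delta> Td"
  \<comment> \<open>Cut rows: pieces \<open>s - 1\<close> and \<open>s\<close> share \<Delta>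
    symbols of \<open>P\<close> from position \<open>?p s\<close> on, and the cut goes through the
    middle of this overlap. Rows \<open>x 0\<close> and \<open>x z\<close> are the borders of the
    graph.\<close>
  define x where "x s = (if s = 0 then 0 else if s < z then ?p s + \<Delta> div 2 else length P)" for s
  have zS: "Suc (z - 1) = z" using assms(3) by simp
  have "length P = ?p (Suc (z - 1)) + \<Delta> \<and>
      (\<forall>s\<le>z - 1. Pd s = fragment P (?p s) (?p (Suc s) + \<Delta>))"
  proof (rule foldl_odot_fragment)
    show "\<Delta> \<le> length (Pd s)" if "s \<le> z - 1" for s using assms(4)[of s] that assms(3) by simp
  qed (simp_all only: zS assms(6,8))
  then have P: "length P = ?p z + \<Delta>"
      "\<And>s. s < z \<Longrightarrow> Pd s = fragment P (?p s) (?p (Suc s) + \<Delta>)"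
    by (auto simp only: zS less_Suc_eq_le[symmetric])
  have "length T = ?t (Suc (z - 1)) + \<Delta> \<and>
      (\<forall>s\<le>z - 1. Td s = fragment T (?t s) (?t (Suc s) + \<Delta>))"
  proof (rule foldl_odot_fragment)
    show "\<Delta> \<le> length (Td s)" if "s \<le> z - 1" for s using assms(5)[of s] that assms(3) by simp
  qed (simp_all only: zS assms(7,9))
  then have T: "length T = ?t z + \<Delta>"
      "\<And>s. s < z \<Longrightarrow> Td s = fragment T (?t s) (?t (Suc s) + \<Delta>)"
    by (auto simp only: zS less_Suc_eq_le[symmetric])
  have p0: "?p 0 = 0" "?t 0 = 0" by (simp_all add: overlap_offset_def)
  have pS: "?p (Suc s) = ?p s + (length (Pd s) - \<Delta>)" "?t (Suc s) = ?t s + (length (Td s) - \<Delta>)" for s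
    by (simp_all add: overlap_offset_def)
  have p_mono: "?p s \<le> ?p r" "?t s \<le> ?t r" if "s \<le> r" for s r
    unfolding overlap_offset_def by (rule sum_mono2; use that in auto)+
  have x_mono: "x s \<le> x (Suc s)" if "s < z" for s
    using that p_mono(1)[of s "Suc s"] p_mono(1)[of s z] P(1) by (auto simp: x_def)
  have x_le: "x s \<le> length P" if "s \<le> z" for s
    using that p_mono(1)[of s z] P(1) by (auto simp: x_def)
  have x_ends: "x 0 = 0" "x z = length P" using assms(3) by (auto simp: x_def)
  have t_le: "?t s + \<Delta> \<le> length T" if "s \<le> z" for s using p_mono(2)[OF that] T(1) by simp
  \<comment> \<open>\<open>?t q - ?p q\<close> is the sum of the length differences of the first
    \<open>q\<close> pieces, so it varies by at most \<tau> between any two positions.\<close>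
  have drift: "\<bar>(int (?t r) - int (?p r)) - (int (?t s) - int (?p s))\<bar> \<le> \<tau>"
    if "s \<le> r" "r \<le> z" for s r
  proof -
    have eq: "int (?t q) - int (?p q) = (\<Sum>r<q. int (length (Td r)) - int (length (Pd r)))"
      if "q \<le> z" for q
      unfolding overlap_offset_def of_nat_sum sum_subtractf[symmetric]
      by (rule sum.cong) (use that assms(4,5) in \<open>auto simp: of_nat_diff\<close>)
    show ?thesis
      unfolding assms(10) using eq[of r] eq[of s] that
        abs_sum_window_le[OF that, of "\<lambda>r. int (length (Td r)) - int (length (Pd r))"] by simp
  qed

  \<comment> \<open>Cutting \<open>P\<close> at the rows \<open>x\<close> makes the leading,
    internal and trailing matrices one family.\<close>
  define M where "M s = D_mat w W \<Delta> (fragment P (x s) (x (Suc s))) (Td s)" for s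
  have M_carrier: "M s \<in> carrier_mat (\<Delta> + 1) (\<Delta> + 1)" for s
    by (simp add: M_def D_mat_def)
  have lenP: "length (Pd s) = ?p (Suc s) + \<Delta> - ?p s" if "s < z" for s
    using pS(1)[of s] assms(4)[OF that] by simp
  have sub: "fragment (Pd s) c d = fragment P (?p s + c) (?p s + d)"
    if "s < z" "d \<le> length (Pd s)" for s c d
  proof -
    have "?p s + d \<le> ?p (Suc s) + \<Delta>" using lenP[OF that(1)] that(2) p_mono(1)[of s "Suc s"] by simp
    then show ?thesis by (subst P(2)[OF that(1)]) (rule fragment_fragment)
  qed
  \<comment> \<open>Since \<open>\<Delta> - (\<Delta> + 1) div 2 = \<Delta> div 2\<close>, dropping
    the rounded-up half at the end of piece \<open>s\<close> ends at row \<open>x (Suc s)\<close>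
    whenever \<open>Suc s < z\<close>.\<close>
  have cut: "?p s + (length (Pd s) - (\<Delta> + 1) div 2) = ?p (Suc s) + \<Delta> div 2" if "s < z" for s
    using lenP[OF that] p_mono(1)[of s "Suc s"] by linarith
  have lead: "D_lead w W \<Delta> (Pd 0) (Td 0) = M 0"
    using sub[of 0 "length (Pd 0) - (\<Delta> + 1) div 2" 0] cut[of 0] assms(3)
    by (simp add: D_lead_def M_def x_def p0)
  have int: "D_int w W \<Delta> (Pd s) (Td s) = M s" if "s \<in> {1..<z - 1}" for s
  proof -
    have "s < z" "Suc s < z" "s \<noteq> 0" using that by auto
    with sub[of s "length (Pd s) - (\<Delta> + 1) div 2" "\<Delta> div 2"] cut[of s] show ?thesis
      by (simp add: D_int_def M_def x_def)
  qed
  have "?p (z - 1) + length (Pd (z - 1)) = length P"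
    using lenP[of "z - 1"] assms(3) zS P(1) p_mono(1)[of "z - 1" z] by simp
  then have trail: "D_trail w W \<Delta> (Pd (z - 1)) (Td (z - 1)) = M (z - 1)"
    using sub[of "z - 1" "length (Pd (z - 1))" "\<Delta> div 2"] zS assms(3)
    by (simp add: D_trail_def M_def x_def)

  \<comment> \<open>For \<open>l \<le> \<Delta>\<close> these are the vertices that the matrix
    indices stand for: if \<open>0 < s < z\<close>, their columns span the overlap of pieces
    \<open>s - 1\<close> and \<open>s\<close> of \<open>T\<close>; if \<open>s = z\<close>, they are
    the last \<open>\<Delta> + 1\<close> columns.\<close>
  define v where "v s l = (x s, ?t s + l)" for s l
  have v_verts: "v s l \<in> verts (AAG P T)" if "s \<le> z" "l \<le> \<Delta>" for s l
    using x_le[OF that(1)] t_le[OF that(1)] that(2) by (simp add: v_def AAG_def)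
  have M_entry: "M s $$ (i, j) = AAG_dist w W (fragment P (x s) (x (Suc s)))
      (fragment T (?t s) (?t (Suc s) + \<Delta>)) (0, i) (x (Suc s) - x s, ?t (Suc s) - ?t s + j)"
    if "s < z" "i \<le> \<Delta>" "j \<le> \<Delta>" for s i j
    using that T(2)[OF that(1)] p_mono(2)[of s "Suc s"] t_le[of "Suc s"] x_le[of "Suc s"]
    by (simp add: M_def D_mat_def length_fragment)
  have M_ge: "AAG_dist w W P T (v s i) (v (Suc s) j) \<le> M s $$ (i, j)"
    if "s < z" "i \<le> \<Delta>" "j \<le> \<Delta>" for s i j
    using AAG_dist_fragment_ge[OF nw, of "x s" "x (Suc s)" P "?t s" "?t (Suc s) + \<Delta>" T 0
        "x (Suc s) - x s" i "?t (Suc s) - ?t s + j"]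
      that p_mono(2)[of s "Suc s"] t_le[of "Suc s"] x_le[of "Suc s"] x_mono[of s]
    by (simp add: M_entry[OF that] v_def add.commute)
  have M_le: "M s $$ (i, j) \<le> ereal c"
    if "cwalk w W P T ({x s..x (Suc s)} \<times> {?t s..?t (Suc s) + \<Delta>}) (v s i) c (v (Suc s) j)"
      "s < z" "i \<le> \<Delta>" "j \<le> \<Delta>" for s i j c
    using AAG_dist_fragment_le[of w W P T "x s" "x (Suc s)" "?t s" "?t (Suc s) + \<Delta>" 0 i c
        "x (Suc s) - x s" "?t (Suc s) - ?t s + j"]
      that p_mono(2)[of s "Suc s"] t_le[of "Suc s"] x_le[of "Suc s"] x_mono[of s]
    by (simp add: M_entry[OF that(2-4)] v_def add.commute)

  \<comment> \<open>For \<open>z = 2\<close> this is the empty product, the unit matrix.\<close>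
  define B where "B = minplus_prod (\<Delta> + 1) (map M [1..<z - 1])"
  let ?R = "M 0 \<boxplus> B \<boxplus> M (z - 1)"
  have B_dim: "dim_row B = \<Delta> + 1" "dim_col B = \<Delta> + 1"
    unfolding B_def by (rule dim_minplus_prod; use M_carrier in auto)+
  have M_dim: "dim_row (M s) = \<Delta> + 1" "dim_col (M s) = \<Delta> + 1" for s
    using M_carrier[of s] by auto
  have R_eq: "D_lead w W \<Delta> (Pd 0) (Td 0)
      \<boxplus> minplus_prod (\<Delta> + 1) (map (\<lambda>s. D_int w W \<Delta> (Pd s) (Td s)) [1..<z - 1])
      \<boxplus> D_trail w W \<Delta> (Pd (z - 1)) (Td (z - 1)) = ?R"
  proof -
    have "map (\<lambda>s. D_int w W \<Delta> (Pd s) (Td s)) [1..<z - 1] = map M [1..<z - 1]"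
      by (rule map_cong[OF refl], rule int) simp
    then show ?thesis by (simp only: lead trail B_def)
  qed
  have D_entry: "D_mat w W \<Delta> P T $$ (i, j) = AAG_dist w W P T (v 0 i) (v z j)"
    if "i \<le> \<Delta>" "j \<le> \<Delta>" for i j
    using that T(1) by (simp add: D_mat_def v_def x_ends p0)

  \<comment> \<open>Triangle inequality through \<open>v 1 q\<close> and \<open>v (z - 1) l\<close>;
    for the middle factors \<open>G\<close> is the distance to \<open>v (z - 1) l\<close>.\<close>
  have lower: "AAG_dist w W P T (v 0 i) (v z j) \<le> ?R $$ (i, j)" if ij: "i \<le> \<Delta>" "j \<le> \<Delta>" for i j
  proof (rule minplus_ge)
    fix l assume "l < dim_col (M 0 \<boxplus> B)"
    then have l: "l \<le> \<Delta>" by (simp add: dim_minplus B_dim)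
    have "AAG_dist w W P T (v 0 i) (v (z - 1) l) \<le> (M 0 \<boxplus> B) $$ (i, l)"
    proof (rule minplus_ge)
      fix q assume "q < dim_col (M 0)"
      then have q: "q \<le> \<Delta>" by (simp add: M_dim)
      have "AAG_dist w W P T (v 1 q) (v (z - 1) l) \<le> B $$ (q, l)"
        unfolding B_def
      proof (rule minplus_prod_ge[where G = "\<lambda>s l'. AAG_dist w W P T (v s l') (v (z - 1) l)"])
        show "AAG_dist w W P T (v (z - 1) l) (v (z - 1) l) \<le> 0"
          using AAG_dist_self[OF nw v_verts[of "z - 1" l]] l by simp
        fix s a b assume "s \<in> {1..<z - 1}" "a < \<Delta> + 1" "b < \<Delta> + 1"
        then have s: "s < z" "a \<le> \<Delta>" "b \<le> \<Delta>" by auto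
        then have "AAG_dist w W P T (v s a) (v (z - 1) l) \<le>
            AAG_dist w W P T (v s a) (v (Suc s) b) + AAG_dist w W P T (v (Suc s) b) (v (z - 1) l)"
          by (intro AAG_dist_triangle[OF nw] v_verts) (use l in auto)
        also have "\<dots> \<le> M s $$ (a, b) + AAG_dist w W P T (v (Suc s) b) (v (z - 1) l)"
          by (rule add_right_mono[OF M_ge[OF s]])
        finally show "AAG_dist w W P T (v s a) (v (z - 1) l) \<le>
          M s $$ (a, b) + AAG_dist w W P T (v (Suc s) b) (v (z - 1) l)" .
      qed (use M_carrier assms(3) q l in auto)
      with M_ge[of 0 i q] have "AAG_dist w W P T (v 0 i) (v 1 q) + AAG_dist w W P T (v 1 q) (v (z - 1) l)
          \<le> M 0 $$ (i, q) + B $$ (q, l)"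
        using ij q assms(3) by (intro add_mono) auto
      moreover have "AAG_dist w W P T (v 0 i) (v (z - 1) l) \<le>
          AAG_dist w W P T (v 0 i) (v 1 q) + AAG_dist w W P T (v 1 q) (v (z - 1) l)"
        by (intro AAG_dist_triangle[OF nw] v_verts) (use ij l q assms(3) in auto)
      ultimately show "AAG_dist w W P T (v 0 i) (v (z - 1) l) \<le> M 0 $$ (i, q) + B $$ (q, l)"
        by (rule order_trans[rotated])
    qed (use ij l B_dim M_dim in auto)
    with M_ge[of "z - 1" l j]
    have "AAG_dist w W P T (v 0 i) (v (z - 1) l) + AAG_dist w W P T (v (z - 1) l) (v z j)
        \<le> (M 0 \<boxplus> B) $$ (i, l) + M (z - 1) $$ (l, j)"
      using ij l assms(3) zS by (intro add_mono) auto
    moreover have "AAG_dist w W P T (v 0 i) (v z j) \<le>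
        AAG_dist w W P T (v 0 i) (v (z - 1) l) + AAG_dist w W P T (v (z - 1) l) (v z j)"
      by (intro AAG_dist_triangle[OF nw] v_verts) (use ij l in auto)
    ultimately show "AAG_dist w W P T (v 0 i) (v z j) \<le> (M 0 \<boxplus> B) $$ (i, l) + M (z - 1) $$ (l, j)"
      by (rule order_trans[rotated])
  qed (use ij B_dim M_dim dim_minplus in auto)

  \<comment> \<open>An entry that is at least \<open>k\<close> is settled by \<open>lower\<close>,
    as both sides are then at least \<open>k\<close>. It remains to treat entries below
    \<open>k\<close>.\<close>
  have upper: "?R $$ (i, j) \<le> AAG_dist w W P T (v 0 i) (v z j)"
    if ij: "i \<le> \<Delta>" "j \<le> \<Delta>" and lt: "AAG_dist w W P T (v 0 i) (v z j) < ereal (of_int k)" for i j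
  proof -
    obtain C where C: "cwalk w W P T (verts (AAG P T)) (v 0 i) C (v z j)"
        "AAG_dist w W P T (v 0 i) (v z j) = ereal C"
      using AAG_dist_attained[OF nw] v_verts ij by blast
    have Ck: "C < of_int k" using lt C(2) by simp
    let ?cols = "{0..length T}"
    have "cwalk w W P T ({x 0..length P} \<times> ?cols) (x 0, i) C (v z j)"
      using C(1) by (simp add: AAG_def x_ends v_def p0)
    then have "\<exists>y d. y 0 = i \<and>
        (\<forall>s<z - 1. cwalk w W P T ({x s..x (Suc s)} \<times> ?cols) (x s, y s) (d s) (x (Suc s), y (Suc s))) \<and>
        cwalk w W P T ({x (z - 1)..length P} \<times> ?cols) (x (z - 1), y (z - 1)) (d (z - 1)) (v z j) \<and>
        (\<Sum>s\<le>z - 1. d s) \<le> C"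
      by (rule cwalk_split_rows[OF nw, where x = x])
        (use x_mono x_le[of "z - 1"] in \<open>auto simp: v_def x_ends\<close>)
    then obtain y d where y0: "y 0 = i" and
      pieces: "\<forall>s<z - 1. cwalk w W P T ({x s..x (Suc s)} \<times> ?cols) (x s, y s) (d s) (x (Suc s), y (Suc s))"
      and last: "cwalk w W P T ({x (z - 1)..length P} \<times> ?cols) (x (z - 1), y (z - 1)) (d (z - 1)) (v z j)"
      and total: "(\<Sum>s\<le>z - 1. d s) \<le> C"
      by blast
    \<comment> \<open>The points \<open>y\<close> cover the rows up to \<open>x (z - 1)\<close>;
      \<open>u\<close> adds the end of the walk, which gives all \<open>z\<close> pieces one
      form.\<close>
    define u where "u s = (if s = z then v z j else (x s, y s))" for s
    have u: "cwalk w W P T ({x s..x (Suc s)} \<times> ?cols) (u s) (d s) (u (Suc s))" if "s < z" for s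
    proof (cases "s = z - 1")
      case True
      then have "Suc s = z" "s \<noteq> z" using zS that by auto
      then show ?thesis using last True x_ends by (simp add: u_def)
    next
      case False
      then show ?thesis using pieces that by (auto simp: u_def)
    qed
    have u_fst: "fst (u s) = x s" for s by (simp add: u_def v_def)
    have u_ends: "u 0 = v 0 i" "u z = v z j"
      using y0 assms(3) by (auto simp: u_def v_def p0)
    have d_nonneg: "0 \<le> d s" if "s < z" for s by (rule cwalk_cost_nonneg[OF nw u[OF that]])
    have total': "(\<Sum>s\<in>{0..<z}. d s) \<le> C"
      using total zS by (metis atLeast0LessThan lessThan_Suc_atMost)
    \<comment> \<open>Let \<open>(a, b)\<close> split piece \<open>s\<close>. The diagonal changes
      by at most \<open>C\<close> on the way from the start of the whole walk to
      \<open>(a, b)\<close> and on to its end, and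
      \<open>C < \<Delta> div 2 - \<tau>\<close>.\<close>
    have window: "?t s \<le> b \<and> b \<le> ?t (Suc s) + \<Delta>"
      if s: "s < z" and q: "(a, b) \<in> {x s..x (Suc s)} \<times> ?cols"
        and c12: "cwalk w W P T S (u s) c1 (a, b)" "cwalk w W P T S (a, b) c2 (u (Suc s))" "c1 + c2 = d s"
      for s a b c1 c2 S
    proof -
      have c: "0 \<le> c1" "0 \<le> c2" using cwalk_cost_nonneg[OF nw] c12 by auto
      have split: "(\<Sum>r\<in>{0..<s}. d r) + d s + (\<Sum>r\<in>{Suc s..<z}. d r) \<le> C"
        using total' sum.atLeastLessThan_concat[of 0 s z d] s by (simp add: sum.atLeast_Suc_lessThan)
      have nn: "0 \<le> (\<Sum>r\<in>{0..<s}. d r)" "0 \<le> (\<Sum>r\<in>{Suc s..<z}. d r)"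
        by (rule sum_nonneg; use d_nonneg s in auto)+
      have "\<bar>diagonal (u s) - diagonal (u 0)\<bar> \<le> (\<Sum>r\<in>{0..<s}. d r)"
        by (rule diagonal_chain[OF nw, where X = P and Y = T and S = "\<lambda>s. {x s..x (Suc s)} \<times> ?cols"])
          (use u s in auto)
      moreover have "\<bar>diagonal (u z) - diagonal (u (Suc s))\<bar> \<le> (\<Sum>r\<in>{Suc s..<z}. d r)"
        by (rule diagonal_chain[OF nw, where X = P and Y = T and S = "\<lambda>s. {x s..x (Suc s)} \<times> ?cols"])
          (use u s in auto)
      moreover have "\<bar>diagonal (a, b) - diagonal (u s)\<bar> \<le> c1"
        "\<bar>diagonal (u (Suc s)) - diagonal (a, b)\<bar> \<le> c2"
        using cwalk_diagonal[OF nw] c12 by auto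
      ultimately have diag: "diagonal (u 0) - C \<le> diagonal (a, b)" "diagonal (a, b) \<le> diagonal (u z) + C"
        using c c12(3) split nn by linarith+
      have "C < of_int (int (\<Delta> div 2) - \<tau>)"
        using Ck assms(11) by (meson less_le_trans of_int_le_iff)
      then have Cb: "C < real (\<Delta> div 2) - of_int \<tau>" by simp
      have "real a - real b < real (\<Delta> div 2) - of_int \<tau>"
        using diag(1) Cb by (simp add: u_ends v_def x_ends diagonal_def p0)
      then have "of_int (int a - int b) < (of_int (int (\<Delta> div 2) - \<tau>) :: real)" by simp
      then have low: "int a - int b < int (\<Delta> div 2) - \<tau>" unfolding of_int_less_iff .
      have "real b - real a < real (?t z + j) - real (length P) + real (\<Delta> div 2) - of_int \<tau>"
        using diag(2) Cb by (simp add: u_ends v_def x_ends diagonal_def)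
      then have "of_int (int b - int a) <
          (of_int (int (?t z + j) - int (length P) + int (\<Delta> div 2) - \<tau>) :: real)" by simp
      then have high: "int b - int a < int (?t z + j) - int (length P) + int (\<Delta> div 2) - \<tau>"
        unfolding of_int_less_iff .
      \<comment> \<open>Beyond the first piece, \<open>a\<close> is at least
        \<open>?p s + \<Delta> div 2\<close>, so \<open>low\<close> gives
        \<open>b > ?p s + \<tau>\<close>, and \<open>drift\<close> bounds \<open>?t s\<close> by
        that.\<close>
      have "?t s \<le> b"
      proof (cases "s = 0")
        case True
        then show ?thesis by (simp add: p0)
      next
        case False
        then have "?p s + \<Delta> div 2 \<le> a" using q s by (simp add: x_def)
        moreover have "int (?t s) - int (?p s) \<le> \<tau>" using drift[of 0 s] s by (simp add: p0)
        ultimately show ?thesis using low by linarith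
      qed
      \<comment> \<open>Before the last piece, \<open>j \<le> \<Delta>\<close> cancels the \<Delta>
        in \<open>length P\<close>, and \<open>drift\<close> absorbs \<tau>. One half
        \<open>\<Delta> div 2\<close> comes from the cut row and one from \<open>high\<close>;
        together they are at most \<Delta>.\<close>
      moreover have "b \<le> ?t (Suc s) + \<Delta>"
      proof (cases "Suc s = z")
        case True
        then show ?thesis using q T(1) by simp
      next
        case False
        then have "a \<le> ?p (Suc s) + \<Delta> div 2" using q s by (simp add: x_def)
        moreover have "int (?t z) - int (?p z) - (int (?t (Suc s)) - int (?p (Suc s))) \<le> \<tau>"
          using drift[of "Suc s" z] s by simp
        ultimately show ?thesis using high ij(2) P(1) by linarith
      qed
      ultimately show ?thesis ..
    qed
    \<comment> \<open>The ends of a piece split it trivially, with one part of cost 0.\<close>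
    have u_window: "?t s \<le> snd (u s) \<and> snd (u (Suc s)) \<le> ?t (Suc s) + \<Delta>" if "s < z" for s
    proof -
      let ?S = "{x s..x (Suc s)} \<times> ?cols"
      note ends = cwalk_ends[OF u[OF that]]
      have "?t s \<le> snd (u s)"
        using window[OF that, of "fst (u s)" "snd (u s)" ?S 0 "d s"]
          cwalk_Nil[OF ends(1), of w W P T] u[OF that] ends(1) by simp
      moreover have "snd (u (Suc s)) \<le> ?t (Suc s) + \<Delta>"
        using window[OF that, of "fst (u (Suc s))" "snd (u (Suc s))" ?S "d s" 0]
          cwalk_Nil[OF ends(2), of w W P T] u[OF that] ends(2) by simp
      ultimately show ?thesis ..
    qed
    define l where "l s = snd (u s) - ?t s" for s
    \<comment> \<open>The lower bound comes from the piece that starts at \<open>u s\<close>, the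
      upper bound from the piece that ends there; the outer ends of the walk have their indices
      \<open>i\<close> and \<open>j\<close>.\<close>
    have l: "u s = v s (l s) \<and> l s \<le> \<Delta>" if "s \<le> z" for s
    proof -
      have "?t s \<le> snd (u s)" using u_window[of s] that u_ends(2) by (cases "s = z") (auto simp: v_def)
      moreover have "snd (u s) \<le> ?t s + \<Delta>"
        using u_window[of "s - 1"] that u_ends(1) ij by (cases s) (auto simp: v_def)
      ultimately show ?thesis
        using u_fst[of s] by (auto simp: v_def l_def prod_eq_iff)
    qed
    have piece_le: "M s $$ (l s, l (Suc s)) \<le> ereal (d s)" if "s < z" for s
    proof (rule M_le)
      \<comment> \<open>By \<open>cwalk_through\<close> the piece runs only through vertices that
        split it, so \<open>window\<close> confines all of it to the columns of
        \<open>Td s\<close>.\<close>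
      have "cwalk w W P T ({x s..x (Suc s)} \<times> {?t s..?t (Suc s) + \<Delta>}) (u s) (d s) (u (Suc s))"
        by (rule cwalk_mono[OF cwalk_through[OF u[OF that]]]) (use window[OF that] in fastforce)
      then show "cwalk w W P T ({x s..x (Suc s)} \<times> {?t s..?t (Suc s) + \<Delta>})
          (v s (l s)) (d s) (v (Suc s) (l (Suc s)))"
        using l[of s] l[of "Suc s"] that by simp
    qed (use that l in auto)
    have l_ends: "l 0 = i" "l z = j" using u_ends by (auto simp: l_def v_def)
    \<comment> \<open>The columns in which the walk meets the cut rows supply the indices
      \<open>l\<close> for all the minima.\<close>
    have "?R $$ (i, j) \<le> (M 0 \<boxplus> B) $$ (l 0, l (z - 1)) + M (z - 1) $$ (l (z - 1), l z)"
      unfolding l_ends by (rule minplus_le) (use ij l[of "z - 1"] B_dim M_dim dim_minplus in auto)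
    also have "\<dots> \<le> M 0 $$ (l 0, l 1) + B $$ (l 1, l (z - 1)) + M (z - 1) $$ (l (z - 1), l z)"
      by (rule add_right_mono, rule minplus_le)
        (use ij l[of 0] l[of 1] l[of "z - 1"] assms(3) B_dim M_dim in auto)
    also have "\<dots> \<le> M 0 $$ (l 0, l 1) + (\<Sum>s\<in>{1..<z - 1}. M s $$ (l s, l (Suc s)))
        + M (z - 1) $$ (l (z - 1), l z)"
      by (rule add_right_mono, rule add_left_mono, unfold B_def, rule minplus_prod_le)
        (use assms(3) M_carrier l in \<open>auto simp: less_Suc_eq_le\<close>)
    also have "\<dots> = (\<Sum>s\<in>{0..<z}. M s $$ (l s, l (Suc s)))"
    proof -
      have "(\<Sum>s\<in>{0..<z}. M s $$ (l s, l (Suc s))) = (\<Sum>s\<in>{0..<Suc (z - 1)}. M s $$ (l s, l (Suc s)))"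
        by (simp only: zS)
      also have "\<dots> = (\<Sum>s\<in>{0..<z - 1}. M s $$ (l s, l (Suc s)))
          + M (z - 1) $$ (l (z - 1), l (Suc (z - 1)))"
        by (rule sum.atLeastLessThan_Suc) simp
      also have "(\<Sum>s\<in>{0..<z - 1}. M s $$ (l s, l (Suc s))) =
          M 0 $$ (l 0, l 1) + (\<Sum>s\<in>{1..<z - 1}. M s $$ (l s, l (Suc s)))"
        using assms(3) by (simp add: sum.atLeast_Suc_lessThan)
      finally show ?thesis by (simp only: zS)
    qed
    also have "\<dots> \<le> (\<Sum>s\<in>{0..<z}. ereal (d s))" by (rule sum_mono) (use piece_le in auto)
    also have "\<dots> \<le> ereal C" using total' by simp
    finally show ?thesis using C(2) by simp
  qed

  have "k_equiv k (D_mat w W \<Delta> P T $$ (i, j)) (?R $$ (i, j))" if "i \<le> \<Delta>" "j \<le> \<Delta>" for i j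
    using lower[OF that] upper[OF that] D_entry[OF that] unfolding k_equiv_def
    by (metis antisym min_absorb1 not_le)
  then show ?thesis
    unfolding R_eq k_equiv_mat_def by (simp add: dim_minplus M_dim D_mat_def less_Suc_eq_le)
qed

end
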